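(* Let $P, Q : (E,R)\,\mathsf{itree}$. Then: (1) if $(s,X)\in\mathsf{failures}(P)$ and $Y \cap \{x \in \Sigma^{\checkmark} \mid s\frown[x]\in\mathsf{traces}(P)\} = \emptyset$ then $(s, X\cup Y)\in\mathsf{failures}(P)$; (2) if $s\in\mathsf{divergences}(P)$ and $t$ is a finite list with all elements in $E$, then $s\frown t\in\mathsf{divergences}(P)$; (3) if $P\approx Q$ then $\mathsf{failures}(P)=\mathsf{failures}(Q)$ and $\mathsf{divergences}(P)=\mathsf{divergences}(Q)$; (4) $P\in\mathsf{divfree}$ iff $\mathsf{divergences}(P)=\emptyset$; (5) if $P\in\mathsf{divfree}$ then for all $s$ and $a$, if $s\frown[a]\in\mathsf{traces}(P)$ then $(s,\{a\})\notin\mathsf{failures}(P)$.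
   Context: For a set $E$ of events and a set $R$ of return values, $(E,R)\,\mathsf{itree}$ is the coinductive datatype (possibly infinite trees) with constructors $\mathsf{Ret}\,r$ ($r\in R$), $\mathsf{Sil}\,P$ (written $\tau P$), and $\mathsf{Vis}\,F$ with $F: E\rightharpoonup (E,R)\,\mathsf{itree}$ a partial function. $\tau^n P$ is $n$-fold $\mathsf{Sil}$; $\mathsf{stop}=\mathsf{Vis}$ of the empty partial function. $P$ is stable if it is not of the form $\mathsf{Sil}\,P'$; $P$ stabilises if $P=\tau^n P'$ for some $n\in\mathbb{N}$ and stable $P'$; $P$ is divergent if it does not stabilise. Big-step transitions $P\xrightarrow{tr}P'$ ($tr$ a finite list over $E$): least relation with $P\xrightarrow{[]}P$; $P\xrightarrow{tr}P'$ implies $\mathsf{Sil}\,P\xrightarrow{tr}P'$; $e\in\mathrm{dom}(F)$ and $F(e)\xrightarrow{tr}P'$ imply $\mathsf{Vis}\,F\xrightarrow{e\# tr}P'$. Let $\Sigma=E$ and $\Sigma^{\checkmark}=E\cup\{\checkmark_x\mid x\in R\}$ (disjoint union, $\checkmark_x$ fresh termination events). For a list $s$, $\mathrm{set}(s)$ is its set of elements; $\frown$ is concatenation. Step relation: $P\xRightarrow{s}P'$ iff either ($s=t\frown[\checkmark_x]$ for some list $t$ over $E$ and some $x$ with $P\xrightarrow{t}\mathsf{Ret}\,x$ and $P'=\mathsf{stop}$) or ($\mathrm{set}(s)\subseteq E$ and $P\xrightarrow{s}P'$). $\mathsf{traces}(P)=\{s\mid \mathrm{set}(s)\subseteq\Sigma^{\checkmark}\wedge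 \exists P'.\,P\xRightarrow{s}P'\}$. For $X\subseteq\Sigma^{\checkmark}$, $P\ \mathsf{ref}\ X$ iff ($P=\mathsf{Vis}\,F$ with $X\cap\mathrm{dom}(F)=\emptyset$) or ($P=\mathsf{Ret}\,x$ with $\checkmark_x\notin X$). $\mathsf{failures}(P)=\{(s,X)\mid \mathrm{set}(s)\subseteq\Sigma^{\checkmark}\wedge\exists Q.\,P\xRightarrow{s}Q\wedge Q\ \mathsf{ref}\ X\}$. $\mathsf{divergences}(P)=\{s\frown t\mid \mathrm{set}(s)\subseteq E\wedge\mathrm{set}(t)\subseteq E\wedge\exists Q.\,P\xRightarrow{s}Q\wedge Q \text{ divergent}\}$. Divergence freedom: for a set $\mathcal{R}$ of itrees, $P\trianglerighteq\mathcal{R}$ is defined inductively by $\mathsf{Ret}\,x\trianglerighteq\mathcal{R}$; $P\trianglerighteq\mathcal{R}$ implies $\mathsf{Sil}\,P\trianglerighteq\mathcal{R}$; $\mathrm{ran}(F)\subseteq\mathcal{R}$ implies $\mathsf{Vis}\,F\trianglerighteq\mathcal{R}$. $\mathsf{divfree}=\bigcup\{\mathcal{R}\mid \mathcal{R}\subseteq\{P\mid P\trianglerighteq\mathcal{R}\}\}$. Weak bisimilarity $\approx$ is the greatest relation $\mathcal{W}$ such that whenever $(P,Q)\in\mathcal{W}$, either $P=\mathsf{Sil}\,P'$, $Q=\mathsf{Sil}\,Q'$ with $(P',Q')\in\mathcal{W}$, or $P=\tau^m P'$, $Q=\tau^n Q'$ with $P',Q'$ stable and either $P'=Q'=\mathsf{Ret}\,x$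 for some $x$, or $P'=\mathsf{Vis}\,F$, $Q'=\mathsf{Vis}\,G$ with $\mathrm{dom}(F)=\mathrm{dom}(G)$ and $(F(e),G(e))\in\mathcal{W}$ for all $e\in\mathrm{dom}(F)$. *)

theory Defs
  imports Main
begin

text \<open>The event set and the return set are the type parameters, so
  side conditions saying that something consists of events in
  \<open>E\<close> or \<open>\<Sigma>\<^sup>\<checkmark>\<close> are carried by the types wherever possible.\<close>

codatatype ('e, 'r) itree =
    Ret 'r
  | Sil "('e, 'r) itree"
  | Vis "'e \<rightharpoonup> ('e, 'r) itree"

abbreviation Sils :: "nat \<Rightarrow> ('e, 'r) itree \<Rightarrow> ('e, 'r) itree" where
  "Sils n P \<equiv> (Sil ^^ n) P"

definition stop :: "('e, 'r) itree" where
  "stop = Vis Map.empty"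

definition stable :: "('e, 'r) itree \<Rightarrow> bool" where
  "stable P \<longleftrightarrow> (\<nexists>P'. P = Sil P')"

definition stabilises :: "('e, 'r) itree \<Rightarrow> bool" where
  "stabilises P \<longleftrightarrow> (\<exists>n P'. stable P' \<and> P = Sils n P')"

definition divergent :: "('e, 'r) itree \<Rightarrow> bool" where
  "divergent P \<longleftrightarrow> \<not> stabilises P"

inductive trace_to :: "('e, 'r) itree \<Rightarrow> 'e list \<Rightarrow> ('e, 'r) itree \<Rightarrow> bool" where
  trace_to_Nil: "trace_to P [] P"
| trace_to_Sil: "trace_to P tr P' \<Longrightarrow> trace_to (Sil P) tr P'"
| trace_to_Vis: "e \<in> dom F \<Longrightarrow> trace_to (the (F e)) tr P' \<Longrightarrow> trace_to (Vis F) (e # tr) P'"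

text \<open>The type of \<open>\<Sigma>\<^sup>\<checkmark>\<close>; the subset \<open>\<Sigma>\<close> is \<open>range Ev\<close>,
  and lists over \<open>\<Sigma>\<close> are exactly those of the form \<open>map Ev t\<close>.\<close>

datatype ('e, 'r) tick_event = Ev 'e | Tick 'r

definition step_to :: "('e, 'r) itree \<Rightarrow> ('e, 'r) tick_event list \<Rightarrow> ('e, 'r) itree \<Rightarrow> bool" where
  "step_to P s P' \<longleftrightarrow>
     (\<exists>t x. s = map Ev t @ [Tick x] \<and> trace_to P t (Ret x) \<and> P' = stop) \<or>
     (\<exists>t. s = map Ev t \<and> trace_to P t P')"

definition traces :: "('e, 'r) itree \<Rightarrow> ('e, 'r) tick_event list set" where
  "traces P = {s. \<exists>P'. step_to P s P'}"

definition refuses :: "('e, 'r) itree \<Rightarrow> ('e, 'r) tick_event set \<Rightarrow> bool" where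
  "refuses P X \<longleftrightarrow>
     (\<exists>F. P = Vis F \<and> X \<inter> Ev ` dom F = {}) \<or> (\<exists>x. P = Ret x \<and> Tick x \<notin> X)"

definition failures ::
  "('e, 'r) itree \<Rightarrow> (('e, 'r) tick_event list \<times> ('e, 'r) tick_event set) set" where
  "failures P = {(s, X). \<exists>Q. step_to P s Q \<and> refuses Q X}"

definition divergences :: "('e, 'r) itree \<Rightarrow> ('e, 'r) tick_event list set" where
  "divergences P =
     {s @ t | s t. set s \<subseteq> range Ev \<and> set t \<subseteq> range Ev \<and> (\<exists>Q. step_to P s Q \<and> divergent Q)}"

inductive div_free_to :: "('e, 'r) itree set \<Rightarrow> ('e, 'r) itree \<Rightarrow> bool"
  for \<R> :: "('e, 'r) itree set" where
  div_free_to_Ret: "div_free_to \<R> (Ret x)"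
| div_free_to_Sil: "div_free_to \<R> P \<Longrightarrow> div_free_to \<R> (Sil P)"
| div_free_to_Vis: "ran F \<subseteq> \<R> \<Longrightarrow> div_free_to \<R> (Vis F)"

definition divfree :: "('e, 'r) itree set" where
  "divfree = \<Union> {\<R>. \<R> \<subseteq> {P. div_free_to \<R> P}}"

coinductive weak_bisim :: "('e, 'r) itree \<Rightarrow> ('e, 'r) itree \<Rightarrow> bool" where
  weak_bisim_Sil: "weak_bisim P Q \<Longrightarrow> weak_bisim (Sil P) (Sil Q)"
| weak_bisim_Ret: "weak_bisim (Sils m (Ret x)) (Sils n (Ret x))"
| weak_bisim_Vis: "dom F = dom G \<Longrightarrow> \<forall>e\<in>dom F. weak_bisim (the (F e)) (the (G e)) \<Longrightarrow>
    weak_bisim (Sils m (Vis F)) (Sils n (Vis G))"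

end

theory Submission
  imports Defs
begin

text \<open>Every silent step of an itree is its only step, so the stable state reached by a given
  trace is unique, and a trace that goes on beyond it must pass through it. Hence the refusals
  after a trace are exactly the sets of events that cannot follow, which gives (1) and (5). Weak
  bisimilarity is a simulation for big-step transitions between arbitrary, not only stable,
  states; since it preserves divergence and offered events, (3) follows. For (4), the trees
  all of whose derivatives stabilise form a post-fixed point of the operator defining
  \<^const>\<open>divfree\<close>.\<close>

section \<open>Stability and stabilisation\<close>

inductive_cases trace_to_RetE: "trace_to (Ret x) tr P'"
inductive_cases trace_to_SilE: "trace_to (Sil P) tr P'"
inductive_cases trace_to_VisE: "trace_to (Vis F) tr P'"
inductive_cases div_free_to_SilE: "div_free_to R (Sil P)"

lemma stable_Ret [simp]: "stable (Ret x)"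
  and stable_Vis [simp]: "stable (Vis F)"
  and not_stable_Sil [simp]: "\<not> stable (Sil P)"
  by (auto simp: stable_def)

lemma stable_imp_stabilises: "stable P \<Longrightarrow> stabilises P"
  unfolding stabilises_def by (rule exI[of _ 0]) auto

lemma stabilises_Sil: "stabilises P \<Longrightarrow> stabilises (Sil P)"
  unfolding stabilises_def by (metis funpow.simps(2) o_apply)

lemma stabilises_Sils: "stabilises P \<Longrightarrow> stabilises (Sils n P)"
  by (induction n) (auto intro: stabilises_Sil)

lemma stabilises_Sils_Ret [simp]: "stabilises (Sils n (Ret x))"
  and stabilises_Sils_Vis [simp]: "stabilises (Sils n (Vis F))"
  by (simp_all add: stabilises_Sils stable_imp_stabilises)

text \<open>Peels the finite silent prefix off one \<open>Sil\<close> at a time, so that later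
  arguments need not mention its length \<open>n\<close>.\<close>

lemma stabilises_induct [consumes 1, case_names stable Sil]:
  assumes "stabilises P"
    and "\<And>P. stable P \<Longrightarrow> A P"
    and "\<And>P. stabilises P \<Longrightarrow> A P \<Longrightarrow> A (Sil P)"
  shows "A P"
proof -
  obtain n P' where P': "stable P'" "P = Sils n P'"
    using assms(1) unfolding stabilises_def by blast
  have "A (Sils n P')"
    by (induction n) (auto intro: assms(2,3) P'(1) stabilises_Sils stable_imp_stabilises)
  with P' show ?thesis by simp
qed

section \<open>Composition and determinism of big-step transitions\<close>

lemma trace_to_append: "trace_to P s Q \<Longrightarrow> trace_to Q t Q' \<Longrightarrow> trace_to P (s @ t) Q'"
  by (induction rule: trace_to.induct) (auto intro: trace_to.intros)

lemma trace_to_Sils: "trace_to (Sils n P) [] P"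
  by (induction n) (auto intro: trace_to.intros)

lemma trace_to_Vis_single: "e \<in> dom F \<Longrightarrow> trace_to (Vis F) [e] (the (F e))"
  by (auto intro: trace_to.intros)

text \<open>A \<open>Sil\<close> has a single successor and the event fixes the successor of a
  \<open>Vis\<close>, so the run for \<open>s @ t\<close> retraces the run for \<open>s\<close>. The
  last assumption keeps it from stopping early, among the silent steps just before
  \<open>Q\<close>.\<close>

lemma trace_to_through_stable:
  assumes "trace_to P s Q" "stable Q" "trace_to P (s @ t) Q'" "t \<noteq> [] \<or> stable Q'"
  shows "trace_to Q t Q'"
  using assms
proof (induction rule: trace_to.induct)
  case (trace_to_Sil P tr P')
  \<comment> \<open>If the longer run stops at \<open>Sil P\<close> itself, then \<open>t\<close> is
    empty and \<open>Q'\<close> is unstable, contradicting the last assumption.\<close>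
  from trace_to_Sil.prems(2) show ?case
    by (rule trace_to_SilE) (use trace_to_Sil in auto)
next
  case (trace_to_Vis e F tr P')
  from trace_to_Vis.prems(2) show ?case
    by (rule trace_to_VisE) (use trace_to_Vis in auto)
qed auto

section \<open>Traces with termination events\<close>

lemma map_Ev_eq_iff [simp]: "map Ev t = map Ev u \<longleftrightarrow> t = u"
  by (simp add: inj_map_eq_map inj_def)

lemma map_Ev_neq_Tick [simp]:
  "map Ev t \<noteq> map Ev u @ [Tick x]" "map Ev u @ [Tick x] \<noteq> map Ev t"
proof -
  have "Tick x \<notin> set (map Ev t)" by auto
  then show "map Ev t \<noteq> map Ev u @ [Tick x]" "map Ev u @ [Tick x] \<noteq> map Ev t"
    by (metis in_set_conv_decomp)+
qed

lemma step_to_Ev: "step_to P (map Ev t) Q \<longleftrightarrow> trace_to P t Q"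
  by (auto simp: step_to_def)

lemma step_to_Tick: "step_to P (map Ev t @ [Tick x]) Q \<longleftrightarrow> trace_to P t (Ret x) \<and> Q = stop"
  by (auto simp: step_to_def)

lemma step_toE:
  assumes "step_to P s Q"
  obtains t where "s = map Ev t" "trace_to P t Q"
  | t x where "s = map Ev t @ [Tick x]" "trace_to P t (Ret x)" "Q = stop"
  using assms unfolding step_to_def by blast

lemma traces_Ev_iff: "map Ev t @ [Ev e] \<in> traces P \<longleftrightarrow> (\<exists>Q. trace_to P (t @ [e]) Q)"
  using step_to_Ev[of P "t @ [e]"] by (auto simp: traces_def)

lemma traces_Tick_iff: "map Ev t @ [Tick x] \<in> traces P \<longleftrightarrow> trace_to P t (Ret x)"
  using step_to_Tick[of P t x] by (auto simp: traces_def)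

lemma traces_not_after_Tick: "map Ev t @ [Tick x] @ [a] \<notin> traces P"
proof
  assume "map Ev t @ [Tick x] @ [a] \<in> traces P"
  then obtain Q where "step_to P (map Ev t @ [Tick x] @ [a]) Q" by (auto simp: traces_def)
  then obtain u where "map Ev t @ [Tick x] @ [a] = map Ev u
      \<or> (\<exists>y. (map Ev t @ [Tick x]) @ [a] = map Ev u @ [Tick y])"
    by (auto elim!: step_toE)
  \<comment> \<open>In the second case cancelling the last element leaves \<open>Tick x\<close>
    inside \<open>map Ev u\<close>; in the first it is there already.\<close>
  then have "Tick x \<in> set (map Ev u)"
    by (metis append1_eq_conv in_set_conv_decomp append_Cons append_Nil)
  then show False by auto
qed

section \<open>Refusals and failures\<close>

lemma refuses_imp_stable: "refuses Q X \<Longrightarrow> stable Q"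
  by (auto simp: refuses_def)

lemma refuses_stop: "refuses stop X"
  by (auto simp: refuses_def stop_def)

text \<open>Whatever the state reached by \<open>s\<close> offers, be it an event or termination,
  extends \<open>s\<close> to a longer trace and so lies outside \<open>Y\<close>. After a
  \<open>Tick\<close> the state is \<open>stop\<close>, which refuses everything.\<close>

lemma failures_refusal_extension:
  assumes "(s, X) \<in> failures P" "Y \<inter> {x. s @ [x] \<in> traces P} = {}"
  shows "(s, X \<union> Y) \<in> failures P"
proof -
  obtain Q where Q: "step_to P s Q" "refuses Q X"
    using assms(1) by (auto simp: failures_def)
  from Q(1) have "refuses Q (X \<union> Y)"
  proof (cases rule: step_toE)
    case (1 t)
    have "\<not> (\<exists>F e. Q = Vis F \<and> e \<in> dom F \<and> Ev e \<in> Y)"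
      using assms(2) 1 trace_to_append[OF 1(2)] trace_to_Vis_single
      by (fastforce simp: traces_Ev_iff)
    moreover have "\<not> (\<exists>x. Q = Ret x \<and> Tick x \<in> Y)"
      using assms(2) 1 by (auto simp: traces_Tick_iff)
    ultimately show ?thesis
      using Q(2) unfolding refuses_def by blast
  next
    case 2
    then show ?thesis by (simp add: refuses_stop)
  qed
  with Q(1) show ?thesis by (auto simp: failures_def)
qed

text \<open>A refusing state is stable, so the run witnessing \<open>s @ [a]\<close> passes through
  it, and the state must offer \<open>a\<close>.\<close>

lemma trace_extension_not_refused:
  assumes "s @ [a] \<in> traces P"
  shows "(s, {a}) \<notin> failures P"
proof
  assume "(s, {a}) \<in> failures P"
  then obtain Q where Q: "step_to P s Q" "refuses Q {a}"
    by (auto simp: failures_def)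
  from Q(1) show False
  proof (cases rule: step_toE)
    case (1 t)
    note through = trace_to_through_stable[OF 1(2) refuses_imp_stable[OF Q(2)]]
    show False
    proof (cases a)
      case (Ev e)
      then obtain Q' where "trace_to P (t @ [e]) Q'"
        using assms 1 by (auto simp: traces_Ev_iff)
      then have "trace_to Q [e] Q'" by (rule through) simp
      then show False using Q(2) Ev
        by (auto simp: refuses_def elim: trace_to_RetE trace_to_VisE)
    next
      case (Tick x)
      \<comment> \<open>Termination adds no event, so the continuation is empty and the side
        condition of \<open>through\<close> is met by the stability of \<open>Ret x\<close>.\<close>
      then have "trace_to P (t @ []) (Ret x)"
        using assms 1 by (simp add: traces_Tick_iff)
      then have "trace_to Q [] (Ret x)" by (rule through) simp
      then show False using Q(2) Tick
        by (auto simp: refuses_def elim: trace_to_RetE trace_to_VisE)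
    qed
  next
    case (2 t x)
    then show False using assms traces_not_after_Tick by fastforce
  qed
qed

section \<open>Divergences\<close>

lemma divergences_eq:
  "divergences P = {map Ev u @ t | u t. set t \<subseteq> range Ev \<and> (\<exists>Q. trace_to P u Q \<and> divergent Q)}"
  (is "_ = ?D")
proof
  show "divergences P \<subseteq> ?D"
    \<comment> \<open>A prefix inside \<open>range Ev\<close> contains no \<open>Tick\<close>, so
      only the second clause of \<open>step_to\<close> can produce it.\<close>
    unfolding divergences_def by (fastforce elim!: step_toE)
  show "?D \<subseteq> divergences P"
  proof
    fix s assume "s \<in> ?D"
    then obtain u t Q where "s = map Ev u @ t" "set t \<subseteq> range Ev" "step_to P (map Ev u) Q"
      "divergent Q"
      by (auto simp: step_to_Ev)
    moreover have "set (map Ev u) \<subseteq> range Ev" by auto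
    ultimately show "s \<in> divergences P"
      unfolding divergences_def by blast
  qed
qed

lemma divergences_empty_iff:
  "divergences P = {} \<longleftrightarrow> (\<forall>s Q. trace_to P s Q \<longrightarrow> stabilises Q)"
proof
  assume "divergences P = {}"
  show "\<forall>s Q. trace_to P s Q \<longrightarrow> stabilises Q"
  proof (intro allI impI, rule ccontr)
    fix s Q assume "trace_to P s Q" "\<not> stabilises Q"
    moreover have "set [] \<subseteq> range Ev" by simp
    ultimately have "map Ev s @ [] \<in> divergences P"
      unfolding divergences_eq divergent_def by blast
    with \<open>divergences P = {}\<close> show False by blast
  qed
qed (auto simp: divergences_eq divergent_def)

lemma divergences_extension:
  "s \<in> divergences P \<Longrightarrow> set t \<subseteq> range Ev \<Longrightarrow> s @ t \<in> divergences P"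
  unfolding divergences_def by (clarsimp, metis Un_least append.assoc set_append)

section \<open>Divergence freedom\<close>

lemma div_free_to_imp_stabilises: "div_free_to R P \<Longrightarrow> stabilises P"
  by (induction rule: div_free_to.induct) (auto intro: stabilises_Sil stable_imp_stabilises)

text \<open>Each visible step lands in \<open>R\<close>, where post-fixedness restores
  \<open>div_free_to R\<close>.\<close>

lemma div_free_to_trace_to:
  assumes "trace_to P s Q" "div_free_to R P" "R \<subseteq> {P. div_free_to R P}"
  shows "div_free_to R Q"
  using assms
proof (induction rule: trace_to.induct)
  case (trace_to_Sil P tr P')
  then show ?case by (auto elim: div_free_to_SilE)
next
  case (trace_to_Vis e F tr P')
  from trace_to_Vis.prems(1) have "ran F \<subseteq> R" by (cases rule: div_free_to.cases) auto
  then have "the (F e) \<in> R" using trace_to_Vis.hyps(1) by (auto simp: ran_def)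
  then show ?case using trace_to_Vis by blast
qed auto

lemma divfree_iff_divergences_empty: "P \<in> divfree \<longleftrightarrow> divergences P = {}"
proof
  assume "P \<in> divfree"
  then obtain R where "R \<subseteq> {P. div_free_to R P}" "P \<in> R"
    by (auto simp: divfree_def)
  then show "divergences P = {}"
    unfolding divergences_empty_iff
    by (blast intro: div_free_to_imp_stabilises div_free_to_trace_to)
next
  assume P: "divergences P = {}"
  define R :: "('a, 'b) itree set" where "R = {P. \<forall>s Q. trace_to P s Q \<longrightarrow> stabilises Q}"
  have "div_free_to R P'" if "P' \<in> R" for P'
  proof -
    \<comment> \<open>The empty trace reaches \<open>P'\<close> itself. Induction along its silent
      prefix then builds the inductive derivation of \<open>div_free_to\<close>, which ends at the
      first stable node.\<close>
    have "stabilises P'" using that trace_to_Nil unfolding R_def by blast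
    then show ?thesis using that
    proof (induction rule: stabilises_induct)
      case (stable P)
      show ?case
      proof (cases P)
        case (Vis F)
        \<comment> \<open>Prefixing \<open>e\<close> turns every transition of the child
          \<open>Q\<close> into one of \<open>P\<close>, so \<open>R\<close> is closed under
          children.\<close>
        have "Q \<in> R" if Q: "Q \<in> ran F" for Q
        proof -
          obtain e where "F e = Some Q" using Q by (auto simp: ran_def)
          then have "trace_to Q s Q' \<Longrightarrow> trace_to P (e # s) Q'" for s Q'
            using trace_to_Vis[of e F s Q'] Vis by auto
          then show ?thesis using stable.prems unfolding R_def by blast
        qed
        then show ?thesis using Vis by (auto intro: div_free_to_Vis)
      qed (use stable in \<open>auto intro: div_free_to.intros\<close>)
    next
      case (Sil P)
      then show ?case by (auto simp: R_def intro: trace_to_Sil div_free_to_Sil)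
    qed
  qed
  moreover have "P \<in> R" using P by (simp add: R_def divergences_empty_iff)
  ultimately show "P \<in> divfree" unfolding divfree_def by blast
qed

section \<open>Weak bisimilarity\<close>

lemma weak_bisim_sym: "weak_bisim P Q \<Longrightarrow> weak_bisim Q P"
proof (coinduction arbitrary: P Q)
  case weak_bisim
  then show ?case
  proof (cases rule: weak_bisim.cases)
    case weak_bisim_Sil
    then show ?thesis by auto
  next
    case weak_bisim_Ret
    then show ?thesis by blast
  next
    case (weak_bisim_Vis F G m n)
    then have "dom G = dom F" "\<forall>e\<in>dom G. weak_bisim (the (F e)) (the (G e))" by auto
    with weak_bisim_Vis(1,2) show ?thesis by blast
  qed
qed

text \<open>A silent step of \<open>P\<close> is matched by one of \<open>Q\<close> under
  \<open>weak_bisim_Sil\<close>, and by none under the other two clauses, whose silent prefixes have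
  independent lengths.\<close>

lemma weak_bisim_trace_to:
  assumes "trace_to P s P'" "weak_bisim P Q"
  shows "\<exists>Q'. trace_to Q s Q' \<and> weak_bisim P' Q'"
  using assms
proof (induction arbitrary: Q rule: trace_to.induct)
  case (trace_to_Nil P)
  then show ?case by (blast intro: trace_to.intros)
next
  case (trace_to_Sil P tr P')
  from trace_to_Sil.prems show ?case
  proof (cases rule: weak_bisim.cases)
    case (weak_bisim_Sil Q1)
    then show ?thesis using trace_to_Sil.IH by (auto intro: trace_to.intros)
  next
    case (weak_bisim_Ret m x n)
    \<comment> \<open>Here \<open>m\<close> is positive; removing one \<open>Sil\<close> on the left
      keeps the same clause, with \<open>Q\<close> waiting.\<close>
    then have "weak_bisim P Q" by (cases m) (auto intro: weak_bisim.weak_bisim_Ret)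
    then show ?thesis by (rule trace_to_Sil.IH)
  next
    case (weak_bisim_Vis F G m n)
    then have "weak_bisim P Q" by (cases m) (auto intro: weak_bisim.weak_bisim_Vis)
    then show ?thesis by (rule trace_to_Sil.IH)
  qed
next
  case (trace_to_Vis e F tr P')
  from trace_to_Vis.prems show ?case
  proof (cases rule: weak_bisim.cases)
    case (weak_bisim_Ret m x n)
    then show ?thesis by (cases m) auto
  next
    case (weak_bisim_Vis F' G m n)
    then have "F' = F" by (cases m) auto
    with weak_bisim_Vis trace_to_Vis.hyps(1) have "e \<in> dom G" "weak_bisim (the (F e)) (the (G e))"
      by auto
    moreover from this obtain Q' where "trace_to (the (G e)) tr Q'" "weak_bisim P' Q'"
      using trace_to_Vis.IH by blast
    \<comment> \<open>\<open>Q\<close> first runs through its \<open>n\<close> silent steps on the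
      empty trace, then performs \<open>e\<close>.\<close>
    ultimately show ?thesis
      using trace_to_append[OF trace_to_Sils trace_to.trace_to_Vis] weak_bisim_Vis(2)
      by fastforce
  qed
qed

text \<open>\<open>weak_bisim_Sil\<close> can be used only finitely often along the silent prefix of
  \<open>P\<close>; either other clause exhibits a finite silent prefix of \<open>Q\<close>.\<close>

lemma weak_bisim_stabilises:
  assumes "stabilises P" "weak_bisim P Q"
  shows "stabilises Q"
  using assms
proof (induction arbitrary: Q rule: stabilises_induct)
  case (stable P)
  from stable(2,1) show ?case
    by (cases rule: weak_bisim.cases) auto
next
  case (Sil P)
  from Sil.prems show ?case
    by (cases rule: weak_bisim.cases) (auto intro: Sil.IH stabilises_Sil)
qed

text \<open>Since \<open>P\<close> is stable, \<open>weak_bisim_Sil\<close> is impossible and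
  \<open>m\<close> is 0; \<open>Q\<close> may still have silent steps, and \<open>Q'\<close> is the
  stable tree behind them.\<close>

lemma weak_bisim_refuses:
  assumes "weak_bisim P Q" "refuses P X"
  shows "\<exists>Q'. trace_to Q [] Q' \<and> refuses Q' X"
  using assms(1)
proof (cases rule: weak_bisim.cases)
  case weak_bisim_Sil
  then show ?thesis using assms(2) by (auto simp: refuses_def)
next
  case (weak_bisim_Ret m x n)
  then have "refuses (Ret x) X"
    using assms(2) by (cases m) (auto simp: refuses_def)
  then show ?thesis using weak_bisim_Ret trace_to_Sils by blast
next
  case (weak_bisim_Vis F G m n)
  then have "refuses (Vis G) X"
    using assms(2) by (cases m) (auto simp: refuses_def)
  then show ?thesis using weak_bisim_Vis trace_to_Sils by blast
qed

lemma weak_bisim_failures_subset: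
  assumes "weak_bisim P Q"
  shows "failures P \<subseteq> failures Q"
proof (clarsimp simp: failures_def)
  fix s X P' assume P': "step_to P s P'" "refuses P' X"
  from P'(1) show "\<exists>Q'. step_to Q s Q' \<and> refuses Q' X"
  proof (cases rule: step_toE)
    case (1 t)
    then obtain Q' where "trace_to Q t Q'" "weak_bisim P' Q'"
      using weak_bisim_trace_to assms by blast
    with weak_bisim_refuses[OF this(2) P'(2)] have "\<exists>Q'. trace_to Q t Q' \<and> refuses Q' X"
      using trace_to_append by fastforce
    then show ?thesis using 1 by (simp add: step_to_Ev)
  next
    case (2 t x)
    then obtain Q' where Q': "trace_to Q t Q'" "weak_bisim (Ret x) Q'"
      using weak_bisim_trace_to assms by blast
    from Q'(2) have "trace_to Q' [] (Ret x)"
    proof (cases rule: weak_bisim.cases)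
      case (weak_bisim_Ret m y n)
      then show ?thesis by (cases m) (auto intro: trace_to_Sils)
    next
      case (weak_bisim_Vis F G m n)
      then show ?thesis by (cases m) auto
    qed
    then have "trace_to Q t (Ret x)" using trace_to_append[OF Q'(1)] by fastforce
    then show ?thesis using 2 by (simp add: step_to_Tick refuses_stop)
  qed
qed

lemma weak_bisim_divergences_subset:
  assumes "weak_bisim P Q"
  shows "divergences P \<subseteq> divergences Q"
proof -
  \<comment> \<open>If the matching state \<open>Q'\<close> stabilised, then by symmetry so would
    \<open>P'\<close>.\<close>
  have "\<exists>Q'. trace_to Q u Q' \<and> divergent Q'" if "trace_to P u P'" "divergent P'" for u P'
    using weak_bisim_trace_to[OF that(1) assms] that(2) weak_bisim_stabilises weak_bisim_sym
    unfolding divergent_def by blast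
  then show ?thesis unfolding divergences_eq by blast
qed

theorem theorem14:
  fixes P Q :: "('e, 'r) itree"
  shows
    "(\<forall>s X Y. (s, X) \<in> failures P \<and> Y \<inter> {x. s @ [x] \<in> traces P} = {}
        \<longrightarrow> (s, X \<union> Y) \<in> failures P) \<and>
     (\<forall>s t. s \<in> divergences P \<and> set t \<subseteq> range Ev \<longrightarrow> s @ t \<in> divergences P) \<and>
     (weak_bisim P Q \<longrightarrow> failures P = failures Q \<and> divergences P = divergences Q) \<and>
     (P \<in> divfree \<longleftrightarrow> divergences P = {}) \<and>
     (P \<in> divfree \<longrightarrow> (\<forall>s a. s @ [a] \<in> traces P \<longrightarrow> (s, {a}) \<notin> failures P))"
proof (intro conjI)
  show "weak_bisim P Q \<longrightarrow> failures P = failures Q \<and> divergences P = divergences Q"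
    by (intro impI conjI subset_antisym)
      (simp_all add: weak_bisim_failures_subset weak_bisim_divergences_subset weak_bisim_sym)
qed (simp_all add: failures_refusal_extension divergences_extension
      divfree_iff_divergences_empty trace_extension_not_refused)

end
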